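(* Let $X$ be a complete semimodule over a complete idempotent semiring $\mathbb{S}$, let $V$ be a complete subsemimodule of $X$, let $x\in X$ with $x\notin V$, and let $K:=\{h\in X\mid h\backslash x\leq h\backslash P_V(x)\}$ be the associated complete half-space separating $x$ and $V$. Then $$P_V(x)=P_K(x).$$
   Context: A complete idempotent semiring $(\mathbb{S},\oplus,\otimes)$ is a semiring with idempotent addition such that, for the natural order ($\lambda\le\mu\Leftrightarrow\lambda\oplus\mu=\mu$), every subset has a supremum and the multiplication $\otimes$ distributes over arbitrary suprema on both sides. A complete semimodule $X$ over $\mathbb{S}$ is a (right) semimodule over $\mathbb{S}$, with idempotent addition $\oplus$ and action $(x,\lambda)\mapsto x\lambda$, such that for the natural order ($x\leq y\Leftrightarrow x\oplus y=y$) every subset of $X$ has a supremum and the action distributes over arbitrary suprema in each of its two arguments. A complete subsemimodule of $X$ is a subset stable under arbitrary suprema and under the action of scalars. For $x,y\in X$, $x\backslash y:=\max\{\lambda\in\mathbb{S}\mid x\lambda\leq y\}$. For a complete subsemimodule $V$ of $X$, the canonical projection is $P_V(x):=\max\{v\in V\mid v\leq x\}$. All sets of the form $\{h\in X\mid h\backslash u\le h\backslash v\}$ with $u,v\in X$ (complete half-spaces) are complete subsemimodules of $X$, so $P_K$ is well defined. It is a known theorem (Cohen, Gaubert, Quadrat) that $V\subset K$ and $x\notin K$. *)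

theory Defs
  imports Main
begin

text \<open>
  The order of a type in the following class is the natural order of its addition.  Suprema are
  those of \<^class>\<open>complete_lattice\<close>, whose remaining operations (infima, top, ...) are determined
  by the order and so add no assumption.  \<open>0 = 1\<close> is not excluded.
\<close>

class complete_idempotent_monoid = comm_monoid_add + complete_lattice +
  assumes add_idem: "a + a = a"
    and natural_order: "a \<le> b \<longleftrightarrow> a + b = b"

class complete_idempotent_semiring = semiring_0 + monoid_mult + complete_idempotent_monoid +
  assumes Sup_mult_distrib: "Sup A * b = (SUP a\<in>A. a * b)"
    and mult_Sup_distrib: "b * Sup A = (SUP a\<in>A. b * a)"

locale complete_semimodule =
  fixes act :: "'x::complete_idempotent_monoid \<Rightarrow> 's::complete_idempotent_semiring \<Rightarrow> 'x"
    (infixl "\<bullet>" 70)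
  assumes act_one: "x \<bullet> 1 = x"
    and act_mult: "x \<bullet> (l * m) = (x \<bullet> l) \<bullet> m"
    and act_zero: "x \<bullet> 0 = 0"
    and zero_act: "0 \<bullet> l = 0"
    and act_add: "x \<bullet> (l + m) = x \<bullet> l + x \<bullet> m"
    and add_act: "(x + y) \<bullet> l = x \<bullet> l + y \<bullet> l"
    and Sup_act: "Sup A \<bullet> l = (SUP x\<in>A. x \<bullet> l)"
    and act_Sup: "x \<bullet> Sup L = (SUP l\<in>L. x \<bullet> l)"

definition complete_subsemimodule :: "('x::complete_lattice \<Rightarrow> 's \<Rightarrow> 'x) \<Rightarrow> 'x set \<Rightarrow> bool" where
  "complete_subsemimodule act V \<longleftrightarrow>
     (\<forall>A. A \<subseteq> V \<longrightarrow> Sup A \<in> V) \<and> (\<forall>v\<in>V. \<forall>l. act v l \<in> V)"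

text \<open>The residual of \<open>y\<close> by \<open>x\<close>, i.e. the greatest \<open>l\<close> with \<open>act x l \<le> y\<close>.\<close>

definition residual :: "('x::order \<Rightarrow> 's::order \<Rightarrow> 'x) \<Rightarrow> 'x \<Rightarrow> 'x \<Rightarrow> 's" where
  "residual act x y = (GREATEST l. act x l \<le> y)"

definition canonical_projection :: "'x::order set \<Rightarrow> 'x \<Rightarrow> 'x" where
  "canonical_projection V x = (GREATEST v. v \<in> V \<and> v \<le> x)"

definition complete_halfspace :: "('x::order \<Rightarrow> 's::order \<Rightarrow> 'x) \<Rightarrow> 'x \<Rightarrow> 'x \<Rightarrow> 'x set" where
  "complete_halfspace act u v = {h. residual act h u \<le> residual act h v}"

text \<open>
  The maxima above are attained, so \<open>GREATEST\<close> never takes an unspecified value on complete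
  semimodules and complete subsemimodules; half-spaces are complete subsemimodules.
\<close>

lemma (in complete_semimodule) le_residual_iff: "l \<le> residual act x y \<longleftrightarrow> x \<bullet> l \<le> y"
proof -
  let ?m = "Sup {l. x \<bullet> l \<le> y}"
  have mono: "x \<bullet> l \<le> x \<bullet> m" if "l \<le> m" for l m
    using that by (metis act_add natural_order)
  have m: "x \<bullet> ?m \<le> y"
    by (auto simp: act_Sup intro: Sup_least)
  have "residual act x y = ?m"
    unfolding residual_def by (rule Greatest_equality) (use m in \<open>auto intro: Sup_upper\<close>)
  then show ?thesis
    using order_trans[OF mono m] by (auto intro: Sup_upper)
qed

lemma canonical_projection_greatest:
  assumes "complete_subsemimodule act V"
  shows "canonical_projection V x \<in> V" and "canonical_projection V x \<le> x"
    and "v \<in> V \<Longrightarrow> v \<le> x \<Longrightarrow> v \<le> canonical_projection V x"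
proof -
  let ?m = "Sup {v \<in> V. v \<le> x}"
  have m: "?m \<in> V \<and> ?m \<le> x"
    using assms by (auto simp: complete_subsemimodule_def intro: Sup_least)
  have eq: "canonical_projection V x = ?m"
    unfolding canonical_projection_def
    by (rule Greatest_equality) (use m in \<open>auto intro: Sup_upper\<close>)
  show "canonical_projection V x \<in> V" "canonical_projection V x \<le> x"
    using m by (simp_all add: eq)
  show "v \<in> V \<Longrightarrow> v \<le> x \<Longrightarrow> v \<le> canonical_projection V x"
    by (auto simp: eq intro: Sup_upper)
qed

lemma (in complete_semimodule) complete_subsemimodule_halfspace:
  "complete_subsemimodule act (complete_halfspace act u v)"
proof -
  have K: "h \<in> complete_halfspace act u v \<longleftrightarrow> (\<forall>l. h \<bullet> l \<le> u \<longrightarrow> h \<bullet> l \<le> v)" for h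
    unfolding complete_halfspace_def
    by (auto simp: le_residual_iff[symmetric] intro: order_trans)
  show ?thesis
    unfolding complete_subsemimodule_def K
    by (simp add: Sup_act SUP_le_iff K act_mult[symmetric] subset_iff)
qed

end

theory Submission
  imports Defs
begin

text \<open>Membership of h in K means that every multiple of h below x is below P_V(x). The
  multiples of P_V(x) stay in V, so maximality of the projection puts P_V(x) in K, whence P_V(x)
  \<le> P_K(x). Conversely, P_K(x) is in K and below x, so its multiple by 1 gives P_K(x) \<le>
  P_V(x).\<close>

text \<open>An inequality r \<le> s says that every l \<le> r satisfies l \<le> s; residuation then
  turns bounds on l into bounds on \<open>h \<bullet> l\<close>.\<close>

lemma (in complete_semimodule) mem_complete_halfspace_iff:
  "h \<in> complete_halfspace act u v \<longleftrightarrow> (\<forall>l. h \<bullet> l \<le> u \<longrightarrow> h \<bullet> l \<le> v)"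
  unfolding complete_halfspace_def
  by (auto simp: le_residual_iff[symmetric] intro: order_trans)

theorem theorem4p3:
  fixes act :: "'x::complete_idempotent_monoid \<Rightarrow> 's::complete_idempotent_semiring \<Rightarrow> 'x"
    and V K :: "'x set" and x :: 'x
  assumes "complete_semimodule act"
    and "complete_subsemimodule act V"
    and "x \<notin> V"
    and "K = complete_halfspace act x (canonical_projection V x)"
  shows "canonical_projection V x = canonical_projection K x"
proof -
  interpret complete_semimodule act by fact
  let ?p = "canonical_projection V x" and ?q = "canonical_projection K x"
  note p = canonical_projection_greatest[OF assms(2), where x = x]
  have "complete_subsemimodule act K"
    unfolding assms(4) by (rule complete_subsemimodule_halfspace)
  note q = canonical_projection_greatest[OF this, where x = x]
  have K: "h \<in> K \<longleftrightarrow> (\<forall>l. act h l \<le> x \<longrightarrow> act h l \<le> ?p)" for h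
    unfolding assms(4) by (rule mem_complete_halfspace_iff)
  \<comment> \<open>Stability of V under scalars lets \<open>p(3)\<close> bound every multiple of
    \<open>?p\<close> below x, not just \<open>?p\<close> itself.\<close>
  have "act ?p l \<in> V" for l
    using assms(2) p(1) by (simp add: complete_subsemimodule_def)
  then have "?p \<in> K"
    by (simp add: K p(3))
  then have "?p \<le> ?q"
    using p(2) by (rule q(3))
  \<comment> \<open>The scalar 1 makes the criterion speak of \<open>?q\<close> itself, which is
    below x.\<close>
  have "act ?q 1 \<le> x \<longrightarrow> act ?q 1 \<le> ?p"
    using q(1) unfolding K by (rule spec)
  then have "?q \<le> ?p"
    unfolding act_one using q(2) by (rule mp)
  with \<open>?p \<le> ?q\<close> show ?thesis
    by (rule order.antisym)
qed

end
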